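(* For every integer $n\ge 1$ and every permutation $\pi\in\mathcal{S}_n$, \[\mathrm{SP}(n,\pi)=2^{n(n-1)-\mathrm{inv}(\pi)},\qquad \mathrm{SP}(n)=\prod_{i=0}^{n-1}\left(2^n-2^i\right).\]
   Context: Let $[n]=\{1,\dots,n\}$ and let $\mathcal{S}_n$ be the set of permutations of $[n]$ written in one-line notation $\pi=\pi_1\cdots\pi_n$; write $\pi_i^{-1}$ for the position $j$ with $\pi_j=i$. A tuple $(C_1,\dots,C_n)$ of non-empty subsets of $[n]$ is a subset parking function with outcome $\pi\in\mathcal{S}_n$ if for every $1\le i\le n$, the position $j=\pi_i^{-1}$ is the smallest element of $C_i\setminus\{\pi_{i'}^{-1}: i'<i\}$ (car $i$ parks in the leftmost still-empty spot belonging to $C_i$). $\mathrm{SP}(n,\pi)$ is the number of subset parking functions with outcome $\pi$, and $\mathrm{SP}(n)=\sum_{\pi\in\mathcal{S}_n}\mathrm{SP}(n,\pi)$. The inversion number $\mathrm{inv}(\pi)$ is the number of pairs $(i,j)$ with $i<j$ and $\pi_j<\pi_i$. *)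

theory Defs
  imports "HOL-Combinatorics.Permutations" "HOL-Library.FuncSet"
begin

text \<open>
  A permutation \<open>\<pi>\<close> of \<open>[n]\<close> is a function with \<open>\<pi> permutes {1..n}\<close>: \<open>\<pi> j\<close> is the
  car parked in spot \<open>j\<close>, and \<open>inv \<pi> i\<close> is the spot of car \<open>i\<close>. A tuple \<open>(C\<^sub>1, \<dots>, C\<^sub>n)\<close> is an
  extensional function on \<open>{1..n}\<close>, so that distinct tuples are distinct functions and
  the sets counted below are finite.
\<close>

definition is_smallest :: "nat \<Rightarrow> nat set \<Rightarrow> bool" where
  "is_smallest j A \<longleftrightarrow> j \<in> A \<and> (\<forall>k\<in>A. j \<le> k)"

definition subset_parking_functions :: "nat \<Rightarrow> (nat \<Rightarrow> nat) \<Rightarrow> (nat \<Rightarrow> nat set) set" where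
  "subset_parking_functions n \<pi> =
     {C \<in> {1..n} \<rightarrow>\<^sub>E (Pow {1..n} - {{}}).
        \<forall>i\<in>{1..n}. is_smallest (inv \<pi> i) (C i - {inv \<pi> i' | i'. i' \<in> {1..n} \<and> i' < i})}"

definition SP_outcome :: "nat \<Rightarrow> (nat \<Rightarrow> nat) \<Rightarrow> nat" where
  "SP_outcome n \<pi> = card (subset_parking_functions n \<pi>)"

definition SP :: "nat \<Rightarrow> nat" where
  "SP n = (\<Sum>\<pi> | \<pi> permutes {1..n}. SP_outcome n \<pi>)"

definition inversion_number :: "nat \<Rightarrow> (nat \<Rightarrow> nat) \<Rightarrow> nat" where
  "inversion_number n \<pi> = card {(i, j). i \<in> {1..n} \<and> j \<in> {1..n} \<and> i < j \<and> \<pi> j < \<pi> i}"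

text \<open>The exponent \<open>n(n-1) - inv(\<pi>)\<close> can be formed in the natural numbers without truncation.\<close>

lemma inversion_number_le: "inversion_number n \<pi> \<le> n * (n - 1)"
proof -
  let ?T = "SIGMA i:{1..n}. {1..n} - {i}"
  have "inversion_number n \<pi> \<le> card ?T"
    unfolding inversion_number_def by (rule card_mono) auto
  also have "card ?T = (\<Sum>i\<in>{1..n}. card ({1..n} - {i}))"
    by (rule card_SigmaI) auto
  also have "\<dots> = n * (n - 1)" by simp
  finally show ?thesis .
qed

end

theory Submission
  imports Defs
begin

text \<open>
  For a fixed outcome \<open>\<pi>\<close>, the preference sets of the cars can be chosen independently: the set of
  car \<open>i\<close>, parked in spot \<open>p\<close>, must contain \<open>p\<close> and avoid the spots \<open>k < p\<close> with \<open>\<pi> k > i\<close>, which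
  are still empty when \<open>i\<close> arrives. Their number is the number of inversions of \<open>\<pi>\<close> whose right end
  is \<open>p\<close>. For the total, let the cars choose one after the other: after \<open>k\<close> cars have parked,
  the next one can park iff its set is not contained in the set of the \<open>k\<close> occupied spots, so it
  has \<open>2 ^ n - 2 ^ k\<close> choices.
\<close>

section \<open>Preference sets with a prescribed outcome\<close>

lemma card_subsets_containing:
  assumes "finite X" "p \<in> X"
  shows "card {A. p \<in> A \<and> A \<subseteq> X} = 2 ^ (card X - 1)"
proof -
  have "{A. p \<in> A \<and> A \<subseteq> X} = insert p ` Pow (X - {p})"
  proof (intro equalityI subsetI)
    fix A assume "A \<in> {A. p \<in> A \<and> A \<subseteq> X}"
    then have "A = insert p (A - {p})" "A - {p} \<in> Pow (X - {p})" by auto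
    then show "A \<in> insert p ` Pow (X - {p})" by (rule image_eqI)
  qed (use assms in auto)
  moreover have "inj_on (insert p) (Pow (X - {p}))"
    by (rule inj_onI) blast
  ultimately show ?thesis
    using assms by (simp add: card_image card_Pow)
qed

text \<open>The spots already taken are those \<open>k\<close> with \<open>\<pi> k < i\<close>, so
  the parking rule only forbids spots of \<open>A\<close> that lie left of
  \<open>inv \<pi> i\<close> and go to later cars. The rule thus becomes a condition on the set of
  car \<open>i\<close> alone.\<close>

lemma is_smallest_spot_iff:
  assumes \<pi>: "\<pi> permutes {1..n}" and A: "A \<subseteq> {1..n}"
  shows "is_smallest (inv \<pi> i) (A - {inv \<pi> i' | i'. i' \<in> {1..n} \<and> i' < i}) \<longleftrightarrow>
    inv \<pi> i \<in> A \<and> A \<subseteq> {1..n} - {k \<in> {1..n}. k < inv \<pi> i \<and> i < \<pi> k}"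
proof -
  have free: "k \<notin> {inv \<pi> i' | i'. i' \<in> {1..n} \<and> i' < i} \<longleftrightarrow> i \<le> \<pi> k" if "k \<in> {1..n}" for k
  proof -
    have "k \<in> {inv \<pi> i' | i'. i' \<in> {1..n} \<and> i' < i} \<longleftrightarrow> \<pi> k \<in> {1..n} \<and> \<pi> k < i"
    proof
      assume "k \<in> {inv \<pi> i' | i'. i' \<in> {1..n} \<and> i' < i}"
      then obtain i' where "k = inv \<pi> i'" "i' \<in> {1..n}" "i' < i" by blast
      then show "\<pi> k \<in> {1..n} \<and> \<pi> k < i" by (simp only: permutes_inverses[OF \<pi>])
    next
      assume "\<pi> k \<in> {1..n} \<and> \<pi> k < i"
      moreover have "k = inv \<pi> (\<pi> k)" by (simp only: permutes_inverses[OF \<pi>])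
      ultimately show "k \<in> {inv \<pi> i' | i'. i' \<in> {1..n} \<and> i' < i}" by blast
    qed
    moreover have "\<pi> k \<in> {1..n}"
      using that by (simp only: permutes_in_image[OF \<pi>])
    ultimately show ?thesis
      by (meson not_less)
  qed
  have spot: "\<pi> (inv \<pi> i) = i"
    by (simp only: permutes_inverses[OF \<pi>])
  \<comment> \<open>Equality \<open>\<pi> k = i\<close> would put \<open>k\<close> at the spot of
    car \<open>i\<close> itself.\<close>
  have later: "i < \<pi> k" if "i \<le> \<pi> k" "k < inv \<pi> i" for k
  proof -
    have "inv \<pi> (\<pi> k) = k" using permutes_inverses[OF \<pi>] by blast
    then have "\<pi> k \<noteq> i" using that by auto
    then show ?thesis using that by simp
  qed
  have "A - {inv \<pi> i' | i'. i' \<in> {1..n} \<and> i' < i} = {k \<in> A. i \<le> \<pi> k}"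
    using free A by blast
  then have "is_smallest (inv \<pi> i) (A - {inv \<pi> i' | i'. i' \<in> {1..n} \<and> i' < i}) \<longleftrightarrow>
      inv \<pi> i \<in> A \<and> (\<forall>k\<in>A. i \<le> \<pi> k \<longrightarrow> inv \<pi> i \<le> k)"
    by (auto simp: is_smallest_def spot)
  also have "(\<forall>k\<in>A. i \<le> \<pi> k \<longrightarrow> inv \<pi> i \<le> k) \<longleftrightarrow> (\<forall>k\<in>A. \<not> (k < inv \<pi> i \<and> i < \<pi> k))"
    using later by (meson less_imp_le not_le)
  also have "\<dots> \<longleftrightarrow> A \<subseteq> {1..n} - {k \<in> {1..n}. k < inv \<pi> i \<and> i < \<pi> k}"
    using A by blast
  finally show ?thesis .
qed

lemma sum_card_blocked_spots:
  assumes \<pi>: "\<pi> permutes {1..n}"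
  shows "(\<Sum>i\<in>{1..n}. card {k \<in> {1..n}. k < inv \<pi> i \<and> i < \<pi> k}) = inversion_number n \<pi>"
proof -
  let ?S = "SIGMA p:{1..n}. {k \<in> {1..n}. k < p \<and> \<pi> p < \<pi> k}"
  have "(\<Sum>i\<in>{1..n}. card {k \<in> {1..n}. k < inv \<pi> i \<and> i < \<pi> k})
      = (\<Sum>p\<in>{1..n}. card {k \<in> {1..n}. k < p \<and> \<pi> p < \<pi> k})"
    \<comment> \<open>Reindexing from cars to spots, with \<open>i = \<pi> p\<close>.\<close>
    by (subst sum.permute[OF \<pi>]) (simp add: permutes_inverses[OF \<pi>])
  also have "\<dots> = card ?S"
    by (rule card_SigmaI[symmetric]) auto
  \<comment> \<open>Pairs in \<open>?S\<close> list the right end of the inversion first.\<close>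
  also have "\<dots> = card (prod.swap ` ?S)"
    by (rule card_image[symmetric]) simp
  also have "prod.swap ` ?S = {(i, j). i \<in> {1..n} \<and> j \<in> {1..n} \<and> i < j \<and> \<pi> j < \<pi> i}"
    by (auto simp: image_iff)
  finally show ?thesis
    by (simp add: inversion_number_def)
qed

lemma SP_outcome_eq:
  assumes \<pi>: "\<pi> permutes {1..n}"
  shows "SP_outcome n \<pi> = 2 ^ (n * (n - 1) - inversion_number n \<pi>)"
proof -
  let ?F = "\<lambda>i. {k \<in> {1..n}. k < inv \<pi> i \<and> i < \<pi> k}"
  let ?D = "\<lambda>i. {A. inv \<pi> i \<in> A \<and> A \<subseteq> {1..n} - ?F i}"
  have spot: "inv \<pi> i \<in> {1..n}" if "i \<in> {1..n}" for i
    using permutes_in_image[OF permutes_inv[OF \<pi>]] that by auto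
  have "subset_parking_functions n \<pi> = PiE {1..n} ?D"
  proof (rule set_eqI)
    fix C
    have "C i \<in> Pow {1..n} - {{}} \<and>
        is_smallest (inv \<pi> i) (C i - {inv \<pi> i' | i'. i' \<in> {1..n} \<and> i' < i}) \<longleftrightarrow> C i \<in> ?D i" for i
    proof (cases "C i \<subseteq> {1..n}")
      case True
      show ?thesis
        unfolding is_smallest_spot_iff[OF \<pi> True] using True by blast
    qed blast
    then show "C \<in> subset_parking_functions n \<pi> \<longleftrightarrow> C \<in> PiE {1..n} ?D"
      unfolding subset_parking_functions_def PiE_iff mem_Collect_eq by meson
  qed
  then have "SP_outcome n \<pi> = (\<Prod>i\<in>{1..n}. card (?D i))"
    by (simp add: SP_outcome_def card_PiE)
  also have "\<dots> = (\<Prod>i\<in>{1..n}. 2 ^ (n - 1 - card (?F i)))"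
  proof (rule prod.cong[OF refl])
    fix i assume "i \<in> {1..n}"
    then have "card (?D i) = 2 ^ (card ({1..n} - ?F i) - 1)"
      using spot by (intro card_subsets_containing) auto
    also have "card ({1..n} - ?F i) = n - card (?F i)"
      by (subst card_Diff_subset) auto
    finally show "card (?D i) = 2 ^ (n - 1 - card (?F i))"
      by (simp add: diff_commute)
  qed
  also have "\<dots> = 2 ^ (\<Sum>i\<in>{1..n}. n - 1 - card (?F i))"
    by (rule power_sum[symmetric])
  \<comment> \<open>Splitting the sum of natural-number differences requires that no term is
    truncated: a car's own spot is never in \<open>?F i\<close>, which leaves at most
    \<open>n - 1\<close> blocked spots.\<close>
  also have "(\<Sum>i\<in>{1..n}. n - 1 - card (?F i)) = (\<Sum>i\<in>{1..n}. n - 1) - (\<Sum>i\<in>{1..n}. card (?F i))"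
  proof (rule sum_subtractf_nat)
    fix i assume "i \<in> {1..n}"
    then have "card (?F i) \<le> card ({1..n} - {inv \<pi> i})"
      by (intro card_mono) auto
    then show "card (?F i) \<le> n - 1"
      using spot \<open>i \<in> {1..n}\<close> by simp
  qed
  finally show ?thesis
    unfolding sum_card_blocked_spots[OF \<pi>] by simp
qed

section \<open>Counting parkings car by car\<close>

text \<open>Here \<open>f\<close> sends cars to spots, the direction of \<open>inv \<pi>\<close>.
  The number \<open>k\<close> of cars is separate from the street \<open>S\<close>, so that
  induction on \<open>k\<close> can keep \<open>S\<close> fixed.\<close>

definition partial_parkings :: "nat set \<Rightarrow> nat \<Rightarrow> ((nat \<Rightarrow> nat) \<times> (nat \<Rightarrow> nat set)) set" where
  "partial_parkings S k = {(f, C). f \<in> {1..k} \<rightarrow>\<^sub>E S \<and> C \<in> {1..k} \<rightarrow>\<^sub>E Pow S \<and>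
     (\<forall>i\<in>{1..k}. is_smallest (f i) (C i - f ` {1..<i}))}"

text \<open>Makes the spot of a car a function of its set and of the spots taken before.\<close>

lemma is_smallest_iff_Min:
  assumes "finite A"
  shows "is_smallest j A \<longleftrightarrow> A \<noteq> {} \<and> j = Min A"
  using assms by (auto simp: is_smallest_def intro: Min_eqI[symmetric] Min_in)

text \<open>Each car avoids the spots of its predecessors. Hence \<open>k\<close> cars occupy
  exactly \<open>k\<close> spots, the source of the term \<open>2 ^ k\<close> in the
  recursion.\<close>

lemma partial_parkings_inj_on:
  assumes "(f, C) \<in> partial_parkings S k"
  shows "inj_on f {1..k}"
proof (rule linorder_inj_onI)
  fix i j assume "i < j" "i \<in> {1..k}" "j \<in> {1..k}"
  then have "f j \<notin> f ` {1..<j}" "f i \<in> f ` {1..<j}"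
    using assms by (auto simp: partial_parkings_def is_smallest_def)
  then show "f i \<noteq> f j" by metis
qed auto

lemma finite_partial_parkings:
  assumes "finite S"
  shows "finite (partial_parkings S k)"
proof (rule finite_subset)
  show "partial_parkings S k \<subseteq> ({1..k} \<rightarrow>\<^sub>E S) \<times> ({1..k} \<rightarrow>\<^sub>E Pow S)"
    by (auto simp: partial_parkings_def)
  show "finite (({1..k} \<rightarrow>\<^sub>E S) \<times> ({1..k} \<rightarrow>\<^sub>E Pow S))"
    using assms by (intro finite_cartesian_product finite_PiE) auto
qed

lemma partial_parkings_extend:
  assumes S: "finite S" and fC: "(f, C) \<in> partial_parkings S k"
    and A: "A \<subseteq> S" "\<not> A \<subseteq> f ` {1..k}"
  shows "(f(Suc k := Min (A - f ` {1..k})), C(Suc k := A)) \<in> partial_parkings S (Suc k)"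
    (is "(?f, ?C) \<in> _")
proof -
  have sm: "is_smallest (Min (A - f ` {1..k})) (A - f ` {1..k})"
    using A S by (subst is_smallest_iff_Min) (auto intro: finite_subset)
  \<comment> \<open>The half-open interval stops before \<open>Suc k\<close>, so the update is
    invisible there.\<close>
  have im: "?f ` {1..<i} = f ` {1..<i}" if "i \<le> Suc k" for i
    using that by (intro image_cong) auto
  have ivl: "{1..Suc k} = insert (Suc k) {1..k}" by auto
  have "Min (A - f ` {1..k}) \<in> S"
    using sm A by (auto simp: is_smallest_def)
  then have "?f \<in> {1..Suc k} \<rightarrow>\<^sub>E S" "?C \<in> {1..Suc k} \<rightarrow>\<^sub>E Pow S"
    unfolding ivl using fC A by (auto simp: partial_parkings_def intro!: fun_upd_in_PiE PiE_fun_upd)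
  moreover have "is_smallest (?f i) (?C i - ?f ` {1..<i})" if "i \<in> {1..Suc k}" for i
  proof (cases "i = Suc k")
    case True
    then show ?thesis
      using sm im[of i] by (simp add: atLeastLessThanSuc_atLeastAtMost)
  next
    case False
    then show ?thesis
      using fC im[of i] that by (auto simp: partial_parkings_def)
  qed
  ultimately show ?thesis
    by (simp add: partial_parkings_def)
qed

text \<open>The rule for car \<open>i\<close> refers only to cars up to \<open>i\<close>, so
  dropping the last car preserves it.\<close>

lemma partial_parkings_restrict:
  assumes fC: "(f, C) \<in> partial_parkings S (Suc k)"
  shows "(restrict f {1..k}, restrict C {1..k}) \<in> partial_parkings S k"
proof -
  have "restrict f {1..k} ` {1..<i} = f ` {1..<i}" if "i \<in> {1..k}" for i
    using that by (intro image_cong) auto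
  then show ?thesis
    using fC by (auto simp: partial_parkings_def)
qed

lemma partial_parkings_last:
  assumes "(f, C) \<in> partial_parkings S (Suc k)"
  shows "is_smallest (f (Suc k)) (C (Suc k) - f ` {1..k})" and "C (Suc k) \<subseteq> S"
proof -
  have "Suc k \<in> {1..Suc k}" "{1..<Suc k} = {1..k}" by auto
  then show "is_smallest (f (Suc k)) (C (Suc k) - f ` {1..k})" "C (Suc k) \<subseteq> S"
    using assms unfolding partial_parkings_def by fastforce+
qed

lemma card_partial_parkings_Suc:
  assumes S: "finite S"
  shows "card (partial_parkings S (Suc k)) = card (partial_parkings S k) * (2 ^ card S - 2 ^ k)"
proof -
  \<comment> \<open>\<open>?E\<close> holds the sets with which one more car can park.
    \<open>?\<phi>\<close> appends such a car at its leftmost free spot; \<open>?\<psi>\<close>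
    removes the last car, keeping its set but not its spot.\<close>
  let ?E = "\<lambda>(f, C). Pow S - Pow (f ` {1..k})"
  let ?\<phi> = "\<lambda>((f, C), A). (f(Suc k := Min (A - f ` {1..k})), C(Suc k := A))"
  let ?\<psi> = "\<lambda>(f, C). ((restrict f {1..k}, restrict C {1..k}), C (Suc k))"
  have "bij_betw ?\<phi> (Sigma (partial_parkings S k) ?E) (partial_parkings S (Suc k))"
  proof (rule bij_betw_byWitness[where f' = ?\<psi>])
    show "\<forall>x\<in>Sigma (partial_parkings S k) ?E. ?\<psi> (?\<phi> x) = x"
      by (auto simp: partial_parkings_def PiE_iff extensional_def fun_eq_iff)
    show "\<forall>y\<in>partial_parkings S (Suc k). ?\<phi> (?\<psi> y) = y"
    proof
      fix y assume y: "y \<in> partial_parkings S (Suc k)"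
      obtain f C where y_eq: "y = (f, C)" by (cases y)
      note fC = y[unfolded y_eq]
      note last = partial_parkings_last[OF fC]
      \<comment> \<open>The spot forgotten by \<open>?\<psi>\<close> is forced by the retained
        data.\<close>
      have "f (Suc k) = Min (C (Suc k) - f ` {1..k})"
        using is_smallest_iff_Min last S by (meson finite_Diff finite_subset)
      moreover have "restrict f {1..k} ` {1..k} = f ` {1..k}"
        by (intro image_cong) auto
      ultimately show "?\<phi> (?\<psi> y) = y"
        unfolding y_eq using fC by (auto simp: partial_parkings_def PiE_iff extensional_def fun_eq_iff)
    qed
    show "?\<phi> ` Sigma (partial_parkings S k) ?E \<subseteq> partial_parkings S (Suc k)"
    proof (rule image_subsetI)
      fix x assume "x \<in> Sigma (partial_parkings S k) ?E"
      moreover obtain f C A where "x = ((f, C), A)" by (metis surj_pair)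
      ultimately show "?\<phi> x \<in> partial_parkings S (Suc k)"
        using partial_parkings_extend[OF S] by simp
    qed
    show "?\<psi> ` partial_parkings S (Suc k) \<subseteq> Sigma (partial_parkings S k) ?E"
    proof (rule image_subsetI)
      fix y assume y: "y \<in> partial_parkings S (Suc k)"
      obtain f C where y_eq: "y = (f, C)" by (cases y)
      note fC = y[unfolded y_eq]
      have "\<not> C (Suc k) \<subseteq> restrict f {1..k} ` {1..k}"
        using partial_parkings_last(1)[OF fC] by (auto simp: is_smallest_def)
      then show "?\<psi> y \<in> Sigma (partial_parkings S k) ?E"
        unfolding y_eq using partial_parkings_restrict[OF fC] partial_parkings_last(2)[OF fC]
        by simp
    qed
  qed
  then have "card (partial_parkings S (Suc k)) = card (Sigma (partial_parkings S k) ?E)"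
    by (rule bij_betw_same_card[symmetric])
  also have "\<dots> = (\<Sum>x\<in>partial_parkings S k. card (?E x))"
    using S by (intro card_SigmaI finite_partial_parkings) auto
  also have "\<dots> = (\<Sum>x\<in>partial_parkings S k. 2 ^ card S - 2 ^ k)"
  proof (rule sum.cong[OF refl], clarify)
    fix f C assume fC: "(f, C) \<in> partial_parkings S k"
    have "f ` {1..k} \<subseteq> S"
      using fC by (auto simp: partial_parkings_def)
    then have "card (Pow S - Pow (f ` {1..k})) = card (Pow S) - card (Pow (f ` {1..k}))"
      by (intro card_Diff_subset) auto
    then show "card (Pow S - Pow (f ` {1..k})) = 2 ^ card S - 2 ^ k"
      using S card_image[OF partial_parkings_inj_on[OF fC]] by (simp add: card_Pow)
  qed
  finally show ?thesis by simp
qed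

lemma card_partial_parkings:
  assumes "finite S"
  shows "card (partial_parkings S k) = (\<Prod>i<k. 2 ^ card S - 2 ^ i)"
proof (induction k)
  case 0
  \<comment> \<open>On an empty domain, \<open>undefined\<close> everywhere is the only extensional
    function.\<close>
  have "partial_parkings S 0 = {(\<lambda>x. undefined, \<lambda>x. undefined)}"
    by (auto simp: partial_parkings_def)
  then show ?case by simp
next
  case (Suc k)
  then show ?case by (simp add: card_partial_parkings_Suc[OF assms])
qed

section \<open>Complete parkings and permutations\<close>

lemma subset_parking_functions_iff:
  assumes \<pi>: "\<pi> permutes {1..n}"
  shows "C \<in> subset_parking_functions n \<pi> \<longleftrightarrow>
    (restrict (inv \<pi>) {1..n}, C) \<in> partial_parkings {1..n} n"
proof -
  have occupied: "{inv \<pi> i' | i'. i' \<in> {1..n} \<and> i' < i} = restrict (inv \<pi>) {1..n} ` {1..<i}"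
    if "i \<in> {1..n}" for i
    using that by (auto simp: image_iff)
  have "restrict (inv \<pi>) {1..n} \<in> {1..n} \<rightarrow>\<^sub>E {1..n}"
    using permutes_in_image[OF permutes_inv[OF \<pi>]] by auto
  moreover have "(\<forall>i\<in>{1..n}. is_smallest (restrict (inv \<pi>) {1..n} i)
        (C i - restrict (inv \<pi>) {1..n} ` {1..<i})) \<longleftrightarrow>
      (\<forall>i\<in>{1..n}. is_smallest (inv \<pi> i) (C i - {inv \<pi> i' | i'. i' \<in> {1..n} \<and> i' < i}))"
    by (intro ball_cong refl) (simp only: occupied restrict_apply' )
  \<comment> \<open>The spot of car \<open>i\<close> belongs to \<open>C i\<close>, which gives
    non-emptiness.\<close>
  moreover have "C \<in> {1..n} \<rightarrow>\<^sub>E Pow {1..n} - {{}} \<longleftrightarrow> C \<in> {1..n} \<rightarrow>\<^sub>E Pow {1..n}"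
    if "\<forall>i\<in>{1..n}. is_smallest (inv \<pi> i) (C i - {inv \<pi> i' | i'. i' \<in> {1..n} \<and> i' < i})"
    using that unfolding is_smallest_def PiE_iff by blast
  ultimately show ?thesis
    unfolding subset_parking_functions_def partial_parkings_def by blast
qed

text \<open>Placing \<open>n\<close> cars injectively on \<open>n\<close> spots is a bijection, so
  every complete parking has exactly one outcome; the sum over outcomes counts the fibres.\<close>

lemma SP_eq_card_partial_parkings: "SP n = card (partial_parkings {1..n} n)"
proof -
  let ?P = "{\<pi>. \<pi> permutes {1..n}}"
  let ?\<phi> = "\<lambda>(\<pi>, C). (restrict (inv \<pi>) {1..n}, C :: nat \<Rightarrow> nat set)"
  have "bij_betw ?\<phi> (Sigma ?P (subset_parking_functions n)) (partial_parkings {1..n} n)"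
  proof (rule bij_betw_imageI)
    show "inj_on ?\<phi> (Sigma ?P (subset_parking_functions n))"
    proof (rule inj_onI)
      fix x y assume "x \<in> Sigma ?P (subset_parking_functions n)"
        "y \<in> Sigma ?P (subset_parking_functions n)" and "?\<phi> x = ?\<phi> y"
      then obtain \<pi> \<sigma> C where xy: "x = (\<pi>, C)" "y = (\<sigma>, C)"
        and \<pi>: "\<pi> permutes {1..n}" and \<sigma>: "\<sigma> permutes {1..n}"
        and eq: "restrict (inv \<pi>) {1..n} = restrict (inv \<sigma>) {1..n}"
        by auto
      have "inv \<pi> x = inv \<sigma> x" for x
      proof (cases "x \<in> {1..n}")
        case True
        then show ?thesis using fun_cong[OF eq, of x] by (simp only: restrict_apply')
      next
        case False
        then show ?thesis
          using permutes_not_in[OF permutes_inv[OF \<pi>]] permutes_not_in[OF permutes_inv[OF \<sigma>]]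
          by simp
      qed
      then have "inv \<pi> = inv \<sigma>" by blast
      then show "x = y"
        unfolding xy using permutes_inv_inv[OF \<pi>] permutes_inv_inv[OF \<sigma>] by metis
    qed
    show "?\<phi> ` Sigma ?P (subset_parking_functions n) = partial_parkings {1..n} n"
    proof (intro equalityI subsetI)
      fix y assume "y \<in> ?\<phi> ` Sigma ?P (subset_parking_functions n)"
      then obtain \<pi> C where "y = (restrict (inv \<pi>) {1..n}, C)" "\<pi> permutes {1..n}"
        "C \<in> subset_parking_functions n \<pi>" by auto
      then show "y \<in> partial_parkings {1..n} n"
        using subset_parking_functions_iff by blast
    next
      fix y assume y: "y \<in> partial_parkings {1..n} n"
      obtain f C where fC: "y = (f, C)" by (cases y)
      \<comment> \<open>Extends \<open>f\<close> by the identity, as \<open>permutes\<close>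
        demands. Since \<open>f\<close> maps cars to spots, the outcome is
        \<open>inv \<sigma>\<close>.\<close>
      define \<sigma> where "\<sigma> = (\<lambda>x. if x \<in> {1..n} then f x else x)"
      have f: "f \<in> {1..n} \<rightarrow>\<^sub>E {1..n}" and "inj_on f {1..n}"
        using y partial_parkings_inj_on unfolding fC by (auto simp: partial_parkings_def)
      then have "bij_betw f {1..n} {1..n}"
        unfolding bij_betw_def by (intro conjI endo_inj_surj) auto
      then have "bij_betw \<sigma> {1..n} {1..n}"
        by (rule bij_betw_cong[THEN iffD1, rotated]) (simp add: \<sigma>_def)
      then have \<sigma>: "\<sigma> permutes {1..n}"
        by (rule bij_imp_permutes) (simp only: \<sigma>_def if_False)
      have "restrict \<sigma> {1..n} = f"
        using f by (auto simp: \<sigma>_def PiE_iff extensional_def fun_eq_iff)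
      then have "restrict (inv (inv \<sigma>)) {1..n} = f"
        by (simp add: permutes_inv_inv[OF \<sigma>])
      moreover from this have "C \<in> subset_parking_functions n (inv \<sigma>)"
        using y fC subset_parking_functions_iff[OF permutes_inv[OF \<sigma>]] by simp
      ultimately show "y \<in> ?\<phi> ` Sigma ?P (subset_parking_functions n)"
        unfolding fC using permutes_inv[OF \<sigma>] by (intro image_eqI[of _ _ "(inv \<sigma>, C)"]) auto
    qed
  qed
  then have "card (partial_parkings {1..n} n) = card (Sigma ?P (subset_parking_functions n))"
    by (rule bij_betw_same_card[symmetric])
  also have "\<dots> = (\<Sum>\<pi>\<in>?P. card (subset_parking_functions n \<pi>))"
  proof (rule card_SigmaI)
    show "finite ?P" by (simp add: finite_permutations)
    show "\<forall>\<pi>\<in>?P. finite (subset_parking_functions n \<pi>)"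
      unfolding subset_parking_functions_def Collect_conj_eq
      by (intro ballI finite_Int disjI1) (simp add: finite_PiE)
  qed
  finally show ?thesis
    by (simp add: SP_def SP_outcome_def)
qed

theorem theorem1p1:
  fixes n :: nat
  assumes "n \<ge> 1"
  shows "(\<forall>\<pi>. \<pi> permutes {1..n} \<longrightarrow> SP_outcome n \<pi> = 2 ^ (n * (n - 1) - inversion_number n \<pi>))
       \<and> int (SP n) = (\<Prod>i = 0..n - 1. 2 ^ n - 2 ^ i)"
proof (intro conjI allI impI)
  show "SP_outcome n \<pi> = 2 ^ (n * (n - 1) - inversion_number n \<pi>)" if "\<pi> permutes {1..n}" for \<pi>
    using that by (rule SP_outcome_eq)
  have "int (SP n) = (\<Prod>i<n. int (2 ^ n - 2 ^ i))"
    by (simp add: SP_eq_card_partial_parkings card_partial_parkings)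
  \<comment> \<open>From here subtraction is in the integers; \<open>i < n\<close> rules out
    truncation before.\<close>
  also have "\<dots> = (\<Prod>i<n. 2 ^ n - 2 ^ i)"
    by (rule prod.cong) (simp_all add: of_nat_diff)
  \<comment> \<open>Needs \<open>n \<ge> 1\<close>: for \<open>n = 0\<close> the right side would be
    \<open>{0}\<close>.\<close>
  also have "{..<n} = {0..n - 1}"
    using assms by auto
  finally show "int (SP n) = (\<Prod>i = 0..n - 1. 2 ^ n - 2 ^ i)" .
qed

end
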